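(* Let $\Lambda=(\lambda_1,\ldots,\lambda_n)\subset\mathbb{H}^m\simeq\mathbb{R}^{4m}$ lie in the Poincaré domain, i.e. $0\notin\operatorname{conv}\{\lambda_1,\ldots,\lambda_n\}$, let $\xi\in\mathbb{R}^{4m}$ satisfy $\langle\lambda_j,\xi\rangle>0$ for all $j=1,\ldots,n$, and let $r>0$. Then $$\Theta_r:\mathbb{S}_r^{4n-1}\times\mathbb{R}\longrightarrow\mathbb{H}^n\setminus\{0\},\qquad(q,t)\longmapsto\Phi_{t\xi}(q),$$ is a diffeomorphism. Moreover, if $\mathcal{F}_\Lambda$ denotes the foliation of $\mathbb{H}^n$ by the orbits of $\Phi$, then $\Theta_r$ identifies every leaf of $\mathcal{F}_\Lambda$ in $\mathbb{H}^n\setminus\{0\}$ with the product of its intersection with $\mathbb{S}_r^{4n-1}$ and $\mathbb{R}$. Thus $\mathcal{F}_\Lambda$ on $\mathbb{H}^n\setminus\{0\}$ is the open cone over its trace foliation on the sphere.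
   Context: $\mathbb{H}$ denotes the quaternions. The action of $T\in\mathbb{R}^{4m}$ on $\mathbb{H}^n$ is $$\Phi_T(q_1,\ldots,q_n)=\big(e^{\langle\lambda_1,T\rangle}q_1,\ldots,e^{\langle\lambda_n,T\rangle}q_n\big),$$ and $\mathbb{S}_r^{4n-1}=\{q\in\mathbb{H}^n:\|q\|=r\}$. The (possibly singular) foliation $\mathcal{F}_\Lambda$ is the partition of $\mathbb{H}^n$ into orbits of $\Phi$. The trace foliation on $\mathbb{S}_r^{4n-1}$ is the partition induced by intersecting the nonzero orbits with the sphere. "Open cone" means the product decomposition of the leaves under $\Theta_r$ just stated. *)

theory Defs
  imports "HOL-Analysis.Analysis"
begin

section \<open>Quaternions\<close>

text \<open>
  Real-linear combinations of \<open>1, i, j, k\<close> with Hamilton's product and the Euclidean norm.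
  With the instances below, \<open>quat ^ 'm\<close> is the space of \<open>m\<close>-tuples of quaternions, a real Euclidean
  space of dimension \<open>4 m\<close> whose inner product and norm are the standard ones.
\<close>

datatype quat = Quat (qre: real) (qi: real) (qj: real) (qk: real)

lemma quat_eq_iff: "x = y \<longleftrightarrow> qre x = qre y \<and> qi x = qi y \<and> qj x = qj y \<and> qk x = qk y"
  by (cases x; cases y) simp

instantiation quat :: ring_1
begin

definition "0 = Quat 0 0 0 0"
definition "1 = Quat 1 0 0 0"
definition "x + y = Quat (qre x + qre y) (qi x + qi y) (qj x + qj y) (qk x + qk y)"
definition "x - y = Quat (qre x - qre y) (qi x - qi y) (qj x - qj y) (qk x - qk y)"
definition "- x = Quat (- qre x) (- qi x) (- qj x) (- qk x)"
definition "x * y = Quat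
  (qre x * qre y - qi x * qi y - qj x * qj y - qk x * qk y)
  (qre x * qi y + qi x * qre y + qj x * qk y - qk x * qj y)
  (qre x * qj y - qi x * qk y + qj x * qre y + qk x * qi y)
  (qre x * qk y + qi x * qj y - qj x * qi y + qk x * qre y)"

instance
  by standard
    (simp_all add: zero_quat_def one_quat_def plus_quat_def minus_quat_def uminus_quat_def
      times_quat_def quat_eq_iff algebra_simps)

end

instantiation quat :: real_algebra_1
begin

definition "r *\<^sub>R x = Quat (r * qre x) (r * qi x) (r * qj x) (r * qk x)"

instance
  by standard
    (simp_all add: scaleR_quat_def plus_quat_def times_quat_def quat_eq_iff algebra_simps)

end

instantiation quat :: real_inner
begin

definition "inner x y = qre x * qre y + qi x * qi y + qj x * qj y + qk x * qk y"
  for x y :: quat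
definition "norm x = sqrt (inner x x)" for x :: quat
definition "dist x y = norm (x - y)" for x y :: quat
definition "sgn x = x /\<^sub>R norm x" for x :: quat
definition "(uniformity :: (quat \<times> quat) filter) = (INF e\<in>{0<..}. principal {(x, y). dist x y < e})"
definition "open U \<longleftrightarrow> (\<forall>x\<in>U. \<forall>\<^sub>F (x', y) in uniformity. x' = x \<longrightarrow> y \<in> U)" for U :: "quat set"

instance
proof
  fix x y z :: quat and r :: real and U :: "quat set"
  show "dist x y = norm (x - y)" "sgn x = x /\<^sub>R norm x" "norm x = sqrt (inner x x)"
    "(uniformity :: (quat \<times> quat) filter) = (INF e\<in>{0<..}. principal {(x, y). dist x y < e})"
    "open U \<longleftrightarrow> (\<forall>x\<in>U. \<forall>\<^sub>F (x', y) in uniformity. x' = x \<longrightarrow> y \<in> U)"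
    by (simp_all only: dist_quat_def sgn_quat_def norm_quat_def uniformity_quat_def open_quat_def)
  show "inner x y = inner y x" "inner (x + y) z = inner x z + inner y z"
    "inner (r *\<^sub>R x) y = r * inner x y" "0 \<le> inner x x"
    by (simp_all add: inner_quat_def plus_quat_def scaleR_quat_def algebra_simps)
  have "a * a + b * b + c * c + d * d = 0 \<longleftrightarrow> a = 0 \<and> b = 0 \<and> c = 0 \<and> d = 0" for a b c d :: real
    by (smt (verit) mult_eq_0_iff zero_le_square)
  then show "inner x x = 0 \<longleftrightarrow> x = 0"
    by (simp add: inner_quat_def zero_quat_def quat_eq_iff)
qed

end

lemma norm_quat_mult: "norm (x * y) = norm x * norm (y :: quat)"
  unfolding norm_quat_def real_sqrt_mult [symmetric]
  by (simp add: inner_quat_def times_quat_def algebra_simps)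

instantiation quat :: real_normed_div_algebra
begin

definition "inverse x = Quat (qre x) (- qi x) (- qj x) (- qk x) /\<^sub>R inner x x" for x :: quat
definition "x div y = x * inverse y" for x y :: quat

instance
proof
  fix x y :: quat
  show "norm (x * y) = norm x * norm y" by (rule norm_quat_mult)
  show "x div y = x * inverse y" by (simp only: divide_quat_def)
  show "inverse (0 :: quat) = 0"
    by (simp add: inverse_quat_def)
  assume "x \<noteq> 0"
  then have nz: "inner x x \<noteq> 0" by simp
  have "x * Quat (qre x) (- qi x) (- qj x) (- qk x) = inner x x *\<^sub>R 1"
    "Quat (qre x) (- qi x) (- qj x) (- qk x) * x = inner x x *\<^sub>R 1"
    by (simp_all add: quat_eq_iff times_quat_def scaleR_quat_def one_quat_def inner_quat_def)
  with nz show "x * inverse x = 1" "inverse x * x = 1"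
    by (simp_all add: inverse_quat_def)
qed

end

instantiation quat :: euclidean_space
begin

definition "(Basis :: quat set) = {Quat 1 0 0 0, Quat 0 1 0 0, Quat 0 0 1 0, Quat 0 0 0 1}"

instance
proof
  fix u v x :: quat
  show "(Basis :: quat set) \<noteq> {}" "finite (Basis :: quat set)"
    by (simp_all add: Basis_quat_def)
  show "inner u v = (if u = v then 1 else 0)" if "u \<in> Basis" "v \<in> Basis"
    using that unfolding Basis_quat_def inner_quat_def by (elim insertE emptyE) simp_all
  show "(\<forall>u\<in>Basis. inner x u = 0) \<longleftrightarrow> x = 0"
    by (simp add: Basis_quat_def inner_quat_def zero_quat_def) (simp add: quat_eq_iff)
qed

end

lemma DIM_quat_vec: "DIM(quat ^ 'm) = 4 * CARD('m)"
  by (simp add: Basis_quat_def)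


section \<open>Smooth maps and diffeomorphisms between subsets of Euclidean spaces\<close>

text \<open>
  In finite dimensions \<open>f\<close> is of class \<open>C\<^sup>k\<^sup>+\<^sup>1\<close> on an open set iff it is differentiable there and each
  directional derivative \<open>x \<mapsto> Df(x) v\<close> is of class \<open>C\<^sup>k\<close>.
\<close>

primrec Ck_on :: "nat \<Rightarrow> ('a::euclidean_space \<Rightarrow> 'b::euclidean_space) \<Rightarrow> 'a set \<Rightarrow> bool" where
  "Ck_on 0 f U \<longleftrightarrow> continuous_on U f"
| "Ck_on (Suc k) f U \<longleftrightarrow> (\<forall>x\<in>U. f differentiable (at x)) \<and>
     (\<forall>v. Ck_on k (\<lambda>x. frechet_derivative f (at x) v) U)"

text \<open>
  On an arbitrary subset \<open>X\<close>, smoothness means the existence of local smooth extensions to open sets of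
  the ambient space.  When \<open>X\<close> and \<open>Y\<close> are embedded submanifolds, this is the usual notion of a smooth
  map (diffeomorphism) between manifolds.
\<close>

definition smooth_map_on :: "('a::euclidean_space \<Rightarrow> 'b::euclidean_space) \<Rightarrow> 'a set \<Rightarrow> bool" where
  "smooth_map_on f X \<longleftrightarrow>
     (\<forall>x\<in>X. \<exists>U g. open U \<and> x \<in> U \<and> (\<forall>k. Ck_on k g U) \<and> (\<forall>y\<in>U \<inter> X. g y = f y))"

definition diffeomorphism_on ::
  "('a::euclidean_space \<Rightarrow> 'b::euclidean_space) \<Rightarrow> 'a set \<Rightarrow> 'b set \<Rightarrow> bool" where
  "diffeomorphism_on f X Y \<longleftrightarrow>
     bij_betw f X Y \<and> smooth_map_on f X \<and> smooth_map_on (inv_into X f) Y"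


section \<open>The action, its orbit foliation, and cones\<close>

definition Poincare_domain :: "('n::finite \<Rightarrow> quat ^ 'm) \<Rightarrow> bool" where
  "Poincare_domain \<Lambda> \<longleftrightarrow> 0 \<notin> convex hull (range \<Lambda>)"

text \<open>The acting group \<open>\<real>\<^sup>4\<^sup>m\<close> is identified with \<open>quat ^ 'm\<close>.\<close>

definition action :: "('n::finite \<Rightarrow> quat ^ 'm) \<Rightarrow> quat ^ 'm \<Rightarrow> quat ^ 'n \<Rightarrow> quat ^ 'n" where
  "action \<Lambda> T q = (\<chi> j. exp (\<Lambda> j \<bullet> T) *\<^sub>R (q $ j))"

definition orbit :: "('n::finite \<Rightarrow> quat ^ 'm) \<Rightarrow> quat ^ 'n \<Rightarrow> (quat ^ 'n) set" where
  "orbit \<Lambda> q = range (\<lambda>T. action \<Lambda> T q)"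

definition foliation :: "('n::finite \<Rightarrow> quat ^ 'm) \<Rightarrow> (quat ^ 'n) set set" where
  "foliation \<Lambda> = range (orbit \<Lambda>)"

text \<open>
  The leaves in the complement of the origin.  On the orbit of \<open>q\<close> each
  coordinate with \<open>q $ j \<noteq> 0\<close> runs along the open ray through \<open>q $ j\<close>, and in the logarithms of these
  positive scale factors the orbit is a linear subspace.  So every leaf is an
  embedded submanifold, and the subset notion of diffeomorphism above is the right one for leaves.
\<close>

definition punctured_foliation :: "('n::finite \<Rightarrow> quat ^ 'm) \<Rightarrow> (quat ^ 'n) set set" where
  "punctured_foliation \<Lambda> = {L \<in> foliation \<Lambda>. L \<subseteq> UNIV - {0}}"

definition trace_foliation :: "('n::finite \<Rightarrow> quat ^ 'm) \<Rightarrow> real \<Rightarrow> (quat ^ 'n) set set" where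
  "trace_foliation \<Lambda> r = (\<lambda>L. L \<inter> sphere 0 r) ` punctured_foliation \<Lambda>"

definition Theta :: "('n::finite \<Rightarrow> quat ^ 'm) \<Rightarrow> quat ^ 'm \<Rightarrow> (quat ^ 'n) \<times> real \<Rightarrow> quat ^ 'n" where
  "Theta \<Lambda> \<xi> = (\<lambda>(q, t). action \<Lambda> (t *\<^sub>R \<xi>) q)"

text \<open>
  The leaves in \<open>\<F>\<close> are precisely the \<open>\<Theta>\<close>-images of the products of the leaves in \<open>\<G>\<close> with \<open>\<real>\<close>.
\<close>

definition is_open_cone_over ::
  "('a \<times> real \<Rightarrow> 'b) \<Rightarrow> 'b set set \<Rightarrow> 'a set set \<Rightarrow> bool" where
  "is_open_cone_over \<Theta> \<F> \<G> \<longleftrightarrow> \<F> = (\<lambda>K. \<Theta> ` (K \<times> UNIV)) ` \<G>"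

lemma action_0 [simp]: "action \<Lambda> 0 q = q"
  by (simp add: action_def vec_eq_iff)

lemma action_add: "action \<Lambda> (S + T) q = action \<Lambda> S (action \<Lambda> T q)"
  by (simp add: action_def vec_eq_iff inner_add_right exp_add)

lemma partition_foliation: "partition_on UNIV (foliation \<Lambda>)"
proof (rule partition_onI)
  have self: "q \<in> orbit \<Lambda> q" for q
    unfolding orbit_def by (metis action_0 rangeI)
  then show "\<Union> (foliation \<Lambda>) = UNIV" "{} \<notin> foliation \<Lambda>"
    by (auto simp: foliation_def)
  fix K L assume "K \<in> foliation \<Lambda>" "L \<in> foliation \<Lambda>" "K \<noteq> L"
  then obtain p q where KL: "K = orbit \<Lambda> p" "L = orbit \<Lambda> q"
    by (auto simp: foliation_def)
  have sub: "orbit \<Lambda> x \<subseteq> orbit \<Lambda> y" if "action \<Lambda> S x = action \<Lambda> T y" for x y S T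
  proof -
    have "action \<Lambda> R x = action \<Lambda> (R - S + T) y" for R
      using that by (metis action_add diff_add_cancel)
    then show ?thesis by (auto simp: orbit_def)
  qed
  show "disjnt K L"
  proof (rule ccontr)
    assume "\<not> disjnt K L"
    then obtain S T where "action \<Lambda> S p = action \<Lambda> T q"
      unfolding KL disjnt_iff by (auto simp: orbit_def)
    then have "orbit \<Lambda> p = orbit \<Lambda> q"
      by (metis sub subset_antisym)
    with KL \<open>K \<noteq> L\<close> show False by simp
  qed
qed

end

theory Submission
  imports Defs
begin

text \<open>
  Along \<open>t \<mapsto> \<Phi>\<^bsub>-t\<xi>\<^esub>(p)\<close> with \<open>p \<noteq> 0\<close> the squared norm is a nonzero sum of strictly decreasing
  exponentials, so it takes the value \<open>r\<^sup>2\<close> at exactly one time \<open>\<tau>(p)\<close>, and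
  \<open>p \<mapsto> (\<Phi>\<^bsub>-\<tau>(p)\<xi>\<^esub>(p), \<tau>(p))\<close> inverts \<open>\<Theta>\<close>.  The implicit function theorem expresses the derivative
  of \<open>\<tau>\<close> as an elementary function of \<open>p\<close> and \<open>\<tau>(p)\<close>, whence \<open>\<tau>\<close> is smooth by bootstrapping.
  Both maps preserve every leaf, so they restrict to the leaves.
\<close>

section \<open>Calculus of \<open>C\<^sup>k\<close> maps\<close>

text \<open>On an open set, agreement near a point transfers the whole relation
  \<open>has_derivative\<close>. Since \<open>frechet_derivative\<close> is chosen from that
  relation alone, even the chosen derivatives coincide, which lets the induction pass to
  them.\<close>

lemma Ck_on_cong:
  assumes "open U" and "\<And>x. x \<in> U \<Longrightarrow> f x = g x"
  shows "Ck_on k f U \<longleftrightarrow> Ck_on k g U"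
  using assms(2)
proof (induction k arbitrary: f g)
  case 0
  then show ?case by (simp cong: continuous_on_cong)
next
  case (Suc k)
  have der: "(f has_derivative D) (at x) \<longleftrightarrow> (g has_derivative D) (at x)" if "x \<in> U" for x D
    using has_derivative_transform_within_open[OF _ assms(1) that, of _ D UNIV] Suc.prems
    by metis
  then have "f differentiable (at x) \<longleftrightarrow> g differentiable (at x)"
    and "frechet_derivative f (at x) = frechet_derivative g (at x)" if "x \<in> U" for x
    using that by (auto simp: differentiable_def frechet_derivative_def)
  then have "(\<forall>x\<in>U. f differentiable (at x)) \<longleftrightarrow> (\<forall>x\<in>U. g differentiable (at x))"
    and "Ck_on k (\<lambda>x. frechet_derivative f (at x) v) U
      \<longleftrightarrow> Ck_on k (\<lambda>x. frechet_derivative g (at x) v) U" for v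
    by (auto intro!: Suc.IH)
  then show ?case by simp
qed

text \<open>Uniqueness of derivatives lets an explicit formula \<open>D\<close> stand in for the
  chosen \<open>frechet_derivative\<close>; the closure rules below all enter through it.\<close>

lemma Ck_on_SucI:
  assumes "open U" and "\<And>x. x \<in> U \<Longrightarrow> (f has_derivative D x) (at x)"
    and "\<And>v. Ck_on k (\<lambda>x. D x v) U"
  shows "Ck_on (Suc k) f U"
proof -
  have "frechet_derivative f (at x) = D x" if "x \<in> U" for x
    using assms(2)[OF that] by (metis frechet_derivative_at)
  then have "Ck_on k (\<lambda>x. frechet_derivative f (at x) v) U" for v
    using assms(3)[of v] by (subst Ck_on_cong[OF assms(1), of _ "\<lambda>x. D x v"]) auto
  then show ?thesis
    using assms(2) by (auto simp: differentiable_def)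
qed

text \<open>In product-like rules the derivative still contains undifferentiated factors; this
  lowers their class to the one the induction hypothesis expects.\<close>

lemma Ck_on_SucD:
  assumes "Ck_on (Suc k) f U"
  shows "Ck_on k f U"
  using assms
proof (induction k arbitrary: f)
  case 0
  then show ?case
    by (auto intro: continuous_at_imp_continuous_on differentiable_imp_continuous_within)
next
  case (Suc k)
  have "Ck_on k (\<lambda>x. frechet_derivative f (at x) v) U" for v
    using Suc.prems by (intro Suc.IH) (simp only: Ck_on.simps(2)[of "Suc k"])
  moreover have "\<forall>x\<in>U. f differentiable (at x)"
    using Suc.prems by simp
  ultimately show ?case by simp
qed

lemma Ck_on_has_derivative:
  assumes "Ck_on (Suc k) f U" and "x \<in> U"
  shows "(f has_derivative frechet_derivative f (at x)) (at x)"
  using assms by (simp add: frechet_derivative_works[symmetric])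

lemma Ck_on_const: "open U \<Longrightarrow> Ck_on k (\<lambda>x. c) U"
proof (induction k arbitrary: c)
  case (Suc k)
  then show ?case
    by (intro Ck_on_SucI[where D = "\<lambda>x v. 0"]) auto
qed simp

lemma Ck_on_linear:
  assumes "open U" and "bounded_linear f"
  shows "Ck_on k f U"
proof (cases k)
  case 0
  then show ?thesis by (simp add: assms(2) linear_continuous_on)
next
  case (Suc l)
  then show ?thesis
    using assms by (auto intro!: Ck_on_SucI[where D = "\<lambda>x. f"] Ck_on_const
        bounded_linear_imp_has_derivative simp del: Ck_on.simps)
qed

lemma Ck_on_compose_linear:
  assumes "open U" and "bounded_linear L" and "Ck_on k f U"
  shows "Ck_on k (\<lambda>x. L (f x)) U"
  using assms(3)
proof (induction k arbitrary: f)
  case 0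
  then show ?case
    using assms(2) by (simp add: bounded_linear.continuous_on)
next
  case (Suc k)
  then show ?case
    by (intro Ck_on_SucI[OF assms(1), where D = "\<lambda>x v. L (frechet_derivative f (at x) v)"]
        bounded_linear.has_derivative[OF assms(2) Ck_on_has_derivative[OF Suc.prems]]) auto
qed

lemma Ck_on_add:
  assumes "open U" and "Ck_on k f U" and "Ck_on k g U"
  shows "Ck_on k (\<lambda>x. f x + g x) U"
  using assms(2,3)
proof (induction k arbitrary: f g)
  case 0
  then show ?case by (simp add: continuous_on_add)
next
  case (Suc k)
  then show ?case
    by (intro Ck_on_SucI[OF assms(1), where D = "\<lambda>x v.
          frechet_derivative f (at x) v + frechet_derivative g (at x) v"]
        has_derivative_add[OF Ck_on_has_derivative[OF Suc.prems(1)]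
          Ck_on_has_derivative[OF Suc.prems(2)]]) auto
qed

lemma Ck_on_sum:
  assumes "open U" and "\<And>i. i \<in> I \<Longrightarrow> Ck_on k (f i) U"
  shows "Ck_on k (\<lambda>x. \<Sum>i\<in>I. f i x) U"
  using assms by (induction I rule: infinite_finite_induct) (auto intro: Ck_on_const Ck_on_add)

lemma Ck_on_bilinear:
  assumes "open U" and "bounded_bilinear B" and "Ck_on k f U" and "Ck_on k g U"
  shows "Ck_on k (\<lambda>x. B (f x) (g x)) U"
  using assms(3,4)
proof (induction k arbitrary: f g)
  case 0
  then show ?case using assms(2) by (simp add: bounded_bilinear.continuous_on)
next
  case (Suc k)
  have "Ck_on k (\<lambda>x. B (f x) (frechet_derivative g (at x) v)
      + B (frechet_derivative f (at x) v) (g x)) U" for v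
    using Suc.prems by (intro Ck_on_add[OF assms(1)] Suc.IH Suc.prems[THEN Ck_on_SucD]) auto
  moreover have "((\<lambda>x. B (f x) (g x)) has_derivative
      (\<lambda>v. B (f x) (frechet_derivative g (at x) v) + B (frechet_derivative f (at x) v) (g x))) (at x)"
    if "x \<in> U" for x
    by (intro bounded_bilinear.FDERIV[OF assms(2)] Suc.prems[THEN Ck_on_has_derivative, OF that])
  ultimately show ?case
    by (rule Ck_on_SucI[OF assms(1), rotated])
qed

lemmas Ck_on_mult = Ck_on_bilinear[OF _ bounded_bilinear_mult]
lemmas Ck_on_scaleR = Ck_on_bilinear[OF _ bounded_bilinear_scaleR]
lemmas Ck_on_inner = Ck_on_bilinear[OF _ bounded_bilinear_inner]

text \<open>The derivative reproduces \<open>exp (f x)\<close> as a factor, and the induction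
  hypothesis already covers that factor at class \<open>k\<close>. The reciprocal below works the
  same way.\<close>

lemma Ck_on_exp:
  fixes f :: "'a::euclidean_space \<Rightarrow> real"
  assumes "open U" and "Ck_on k f U"
  shows "Ck_on k (\<lambda>x. exp (f x)) U"
  using assms(2)
proof (induction k arbitrary: f)
  case 0
  then show ?case by (simp add: continuous_on_exp)
next
  case (Suc k)
  have "Ck_on k (\<lambda>x. exp (f x)) U"
    by (rule Suc.IH[OF Ck_on_SucD[OF Suc.prems]])
  with Suc.prems show ?case
    by (intro Ck_on_SucI[OF assms(1), where D = "\<lambda>x v.
          frechet_derivative f (at x) v * exp (f x)"]
        has_derivative_eq_rhs[OF has_derivative_exp[OF Ck_on_has_derivative[OF Suc.prems]]]
        Ck_on_mult[OF assms(1)]) (auto simp: mult.commute)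
qed

lemma Ck_on_inverse:
  fixes f :: "'a::euclidean_space \<Rightarrow> real"
  assumes "open U" and "Ck_on k f U" and nz: "\<And>x. x \<in> U \<Longrightarrow> f x \<noteq> 0"
  shows "Ck_on k (\<lambda>x. inverse (f x)) U"
  using assms(2)
proof (induction k)
  case 0
  then show ?case using nz by (simp add: continuous_on_inverse)
next
  case (Suc k)
  have IH: "Ck_on k (\<lambda>x. inverse (f x)) U"
    by (rule Suc.IH[OF Ck_on_SucD[OF Suc.prems]])
  have "Ck_on k (\<lambda>x. - (inverse (f x) * frechet_derivative f (at x) v * inverse (f x))) U" for v
    using Suc.prems
    by (intro Ck_on_compose_linear[OF assms(1) bounded_linear_minus[OF bounded_linear_ident]]
        Ck_on_mult[OF assms(1)] IH) auto
  with Ck_on_has_derivative[OF Suc.prems] nz show ?case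
    by (intro Ck_on_SucI[OF assms(1), where D = "\<lambda>x v.
          - (inverse (f x) * frechet_derivative f (at x) v * inverse (f x))"]
        Deriv.has_derivative_inverse)
qed

lemma Ck_on_divide:
  fixes f g :: "'a::euclidean_space \<Rightarrow> real"
  assumes "open U" and "Ck_on k f U" and "Ck_on k g U" and "\<And>x. x \<in> U \<Longrightarrow> g x \<noteq> 0"
  shows "Ck_on k (\<lambda>x. f x / g x) U"
  unfolding divide_inverse by (intro Ck_on_mult Ck_on_inverse assms)

lemma Ck_on_Pair:
  assumes "open U" and "Ck_on k f U" and "Ck_on k g U"
  shows "Ck_on k (\<lambda>x. (f x, g x)) U"
proof -
  have "Ck_on k (\<lambda>x. (f x, 0) + (0, g x)) U"
    using assms
    by (intro Ck_on_add Ck_on_compose_linear[of U "\<lambda>y. (y, 0)"] Ck_on_compose_linear[of U "Pair 0"]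
        bounded_linear_Pair bounded_linear_ident bounded_linear_zero)
  then show ?thesis by simp
qed

lemma bounded_linear_axis: "bounded_linear (axis i :: 'a::euclidean_space \<Rightarrow> 'a ^ 'n::finite)"
  unfolding linear_conv_bounded_linear[symmetric]
  by (rule linearI) (simp_all add: vec_eq_iff axis_def)

text \<open>A vector is the sum of its components embedded along the axes, which reduces the claim
  to sums and linear maps.\<close>

lemma Ck_on_vec_lambda:
  fixes f :: "'n::finite \<Rightarrow> 'a::euclidean_space \<Rightarrow> 'b::euclidean_space"
  assumes "open U" and "\<And>j. Ck_on k (f j) U"
  shows "Ck_on k (\<lambda>x. \<chi> j. f j x) U"
proof -
  have "Ck_on k (\<lambda>x. \<Sum>j\<in>UNIV. axis j (f j x)) U"
    by (intro Ck_on_sum Ck_on_compose_linear[OF _ bounded_linear_axis] assms)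
  moreover have "(\<Sum>j\<in>UNIV. axis j (f j x)) = (\<chi> j. f j x)" for x
    by (simp add: vec_eq_iff axis_def)
  ultimately show ?thesis by simp
qed

section \<open>Smooth maps and implicit functions\<close>

lemma smooth_map_onI:
  assumes "open U" and "X \<subseteq> U" and "\<And>k. Ck_on k g U" and "\<And>x. x \<in> X \<Longrightarrow> f x = g x"
  shows "smooth_map_on f X"
  unfolding smooth_map_on_def using assms by (metis IntE subset_iff)

text \<open>\<open>inv_into X f\<close> is determined by \<open>f\<close> only on \<open>Y\<close>,
  where it equals \<open>g\<close>; so \<open>g\<close> on \<open>V\<close> serves as the smooth
  extension around every point of \<open>Y\<close>.\<close>

lemma diffeomorphism_onI:
  assumes "\<And>x. x \<in> X \<Longrightarrow> f x \<in> Y" and "\<And>y. y \<in> Y \<Longrightarrow> g y \<in> X"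
    and "\<And>x. x \<in> X \<Longrightarrow> g (f x) = x" and "\<And>y. y \<in> Y \<Longrightarrow> f (g y) = y"
    and "open U" and "X \<subseteq> U" and "\<And>k. Ck_on k f U"
    and "open V" and "Y \<subseteq> V" and "\<And>k. Ck_on k g V"
  shows "diffeomorphism_on f X Y"
proof -
  have bij: "bij_betw f X Y"
    by (rule bij_betw_byWitness[where f' = g]) (use assms(1-4) in auto)
  then have inv: "inv_into X f y = g y" if "y \<in> Y" for y
    using that assms(2,4) by (metis bij_betw_inv_into_left)
  show ?thesis
    unfolding diffeomorphism_on_def
    using bij smooth_map_onI[OF assms(5-7) refl] smooth_map_onI[OF assms(8-10) inv] by blast
qed

text \<open>The inverse function theorem is applied to
  \<open>(p, s) \<mapsto> (p, F (p, s))\<close>, whose derivative is triangular with corner entry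
  \<open>c\<close>. Injectivity in \<open>s\<close> supplies a global left inverse, so continuity
  together with the derivative at a single point is enough.\<close>

lemma implicit_function_has_derivative:
  fixes F :: "'a::euclidean_space \<times> real \<Rightarrow> real"
  assumes "open U" and cont: "continuous_on (U \<times> UNIV) F"
    and inj: "\<And>p. p \<in> U \<Longrightarrow> inj (\<lambda>s. F (p, s))"
    and sol: "\<And>p. p \<in> U \<Longrightarrow> F (p, \<tau> p) = y"
    and "p \<in> U" and der: "(F has_derivative (\<lambda>(v, w). A v + c * w)) (at (p, \<tau> p))" and "c \<noteq> 0"
  shows "(\<tau> has_derivative (\<lambda>v. - A v / c)) (at p)"
proof -
  define f where "f = (\<lambda>z. (fst z, F z))"
  define g where "g = (\<lambda>(q, y). (q, THE s. F (q, s) = y))"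
  have the: "(THE s. F (q, s) = F (q, t)) = t" if "q \<in> U" for q t
    using inj[OF that] by (auto simp: inj_def)
  have left: "g (f z) = z" if "z \<in> U \<times> UNIV" for z
    using that
    by (auto simp: f_def g_def the)
  have contf: "continuous_on (U \<times> UNIV) f"
    unfolding f_def by (intro continuous_intros cont)
  have derf: "(f has_derivative (\<lambda>z. (fst z, case z of (v, w) \<Rightarrow> A v + c * w))) (at (p, \<tau> p))"
    unfolding f_def by (intro has_derivative_Pair has_derivative_fst has_derivative_ident der)
  \<comment> \<open>The candidate inverse derivative comes from solving
    \<open>A v + c * u = w\<close> for \<open>u\<close>.\<close>
  have "(g has_derivative (\<lambda>(v, w). (v, (w - A v) / c))) (at (f (p, \<tau> p)))"
    by (rule has_derivative_inverse_strong[OF _ _ contf left derf])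
      (use assms in \<open>auto simp: open_Times fun_eq_iff\<close>)
  then have "(g has_derivative (\<lambda>(v, w). (v, (w - A v) / c))) (at (p, y))"
    using sol[OF \<open>p \<in> U\<close>] by (simp add: f_def)
  \<comment> \<open>On the slice with \<open>y\<close> fixed the increment \<open>w\<close> is
    0.\<close>
  then have "((\<lambda>q. g (q, y)) has_derivative (\<lambda>v. (v, (0 - A v) / c))) (at p)"
    using has_derivative_compose[OF has_derivative_Pair[OF has_derivative_ident has_derivative_const]]
    by fastforce
  from has_derivative_snd[OF this]
  have "((\<lambda>q. snd (g (q, y))) has_derivative (\<lambda>v. - A v / c)) (at p)"
    by simp
  moreover have "snd (g (q, y)) = \<tau> q" if "q \<in> U" for q
    using the[OF that, of "\<tau> q"] sol[OF that] by (simp add: g_def)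
  ultimately show ?thesis
    using has_derivative_transform_within_open[OF _ \<open>open U\<close> \<open>p \<in> U\<close>] by blast
qed

section \<open>The time at which the flow reaches the sphere\<close>

text \<open>With \<open>a j = \<Lambda> j \<bullet> \<xi>\<close> this is the squared norm after
  flowing back from \<open>p\<close> for time \<open>s\<close>; the factor 2 comes from squaring the
  exponentials.\<close>

definition flow_norm2 :: "('n::finite \<Rightarrow> real) \<Rightarrow> (quat ^ 'n) \<times> real \<Rightarrow> real" where
  "flow_norm2 a = (\<lambda>(p, s). \<Sum>j\<in>UNIV. exp (- (2 * a j * s)) * (p $ j \<bullet> p $ j))"

text \<open>The form \<open>A v + c * w\<close>, with the minus sign kept inside \<open>c\<close>,
  is the one the implicit function lemma matches.\<close>

lemma flow_norm2_has_derivative: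
  "(flow_norm2 a has_derivative
     (\<lambda>(v, w). (\<Sum>j\<in>UNIV. exp (- (2 * a j * s)) * (2 * (p $ j \<bullet> v $ j)))
        + - (\<Sum>j\<in>UNIV. 2 * a j * (exp (- (2 * a j * s)) * (p $ j \<bullet> p $ j))) * w)) (at (p, s))"
  unfolding flow_norm2_def case_prod_beta
  by (rule derivative_eq_intros bounded_linear.has_derivative[OF bounded_linear_vec_nth] refl)+
    (simp add: fun_eq_iff sum.distrib sum_distrib_right sum_distrib_left
      sum_negf sum_subtractf algebra_simps inner_commute)

lemma continuous_on_flow_norm2: "continuous_on S (flow_norm2 a)"
  using flow_norm2_has_derivative[THEN has_derivative_continuous]
  by (force intro: continuous_at_imp_continuous_on)

lemma sum_weighted_inner_pos:
  fixes p :: "quat ^ 'n::finite"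
  assumes "p \<noteq> 0" and "\<And>j. w j > (0::real)"
  shows "(\<Sum>j\<in>UNIV. w j * (p $ j \<bullet> p $ j)) > 0"
proof -
  obtain i where "p $ i \<noteq> 0"
    using assms(1) by (auto simp: vec_eq_iff)
  then show ?thesis
    by (intro sum_pos2[of _ i]) (auto simp: assms(2) less_imp_le)
qed

lemma flow_norm2_strict_antimono:
  assumes "p \<noteq> 0" and "\<And>j. a j > 0" and "s < t"
  shows "flow_norm2 a (p, t) < flow_norm2 a (p, s)"
proof -
  \<comment> \<open>The difference of the two values is itself a weighted sum, with positive weights
    because each exponential strictly decreases.\<close>
  have "0 < (\<Sum>j\<in>UNIV. (exp (- (2 * a j * s)) - exp (- (2 * a j * t))) * (p $ j \<bullet> p $ j))"
    using assms by (intro sum_weighted_inner_pos) auto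
  then show ?thesis
    by (simp add: flow_norm2_def left_diff_distrib sum_subtractf)
qed

lemma inj_flow_norm2:
  assumes "p \<noteq> 0" and "\<And>j. a j > 0"
  shows "inj (\<lambda>s. flow_norm2 a (p, s))"
  by (rule injI) (metis assms flow_norm2_strict_antimono less_irrefl linorder_less_linear)

text \<open>Intermediate value theorem: at late times all terms have decayed below \<open>y\<close>,
  while at a suitable other time one nonzero coordinate alone contributes \<open>y\<close>.\<close>

lemma flow_norm2_surj:
  assumes "p \<noteq> 0" and a: "\<And>j. a j > 0" and "y > 0"
  shows "\<exists>s. flow_norm2 a (p, s) = y"
proof -
  have "((\<lambda>s. \<Sum>j\<in>UNIV. exp (- (2 * a j * s)) * (p $ j \<bullet> p $ j)) \<longlongrightarrow> (\<Sum>j\<in>(UNIV::'a set). 0)) at_top"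
  proof (intro tendsto_sum tendsto_mult_left_zero)
    fix j
    have "filterlim (\<lambda>s. 2 * a j * s) at_top at_top"
      using a[of j] by (intro filterlim_tendsto_pos_mult_at_top[OF tendsto_const]) (auto simp: filterlim_ident)
    then show "((\<lambda>s. exp (- (2 * a j * s))) \<longlongrightarrow> 0) at_top"
      by (intro filterlim_compose[OF exp_at_bot]) (simp add: filterlim_uminus_at_top[symmetric] filterlim_uminus_at_bot)
  qed
  then have "\<forall>\<^sub>F s in at_top. flow_norm2 a (p, s) < y"
    using \<open>y > 0\<close> by (auto simp: flow_norm2_def dest: order_tendstoD(2))
  then obtain s1 where s1: "flow_norm2 a (p, s1) < y"
    by (metis eventually_happens trivial_limit_at_top_linorder)
  obtain i where i: "p $ i \<noteq> 0"
    using assms(1) by (auto simp: vec_eq_iff)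
  define x where "x = p $ i \<bullet> p $ i"
  have "x > 0" using i by (simp add: x_def)
  \<comment> \<open>Chosen so that the \<open>i\<close>-th summand at time \<open>s0\<close> is
    exactly \<open>y\<close>; the other summands are nonnegative.\<close>
  define s0 where "s0 = - ln (y / x) / (2 * a i)"
  have "y = exp (- (2 * a i * s0)) * x"
    using \<open>x > 0\<close> \<open>y > 0\<close> a[of i] by (simp add: s0_def)
  also have "\<dots> \<le> flow_norm2 a (p, s0)"
    unfolding flow_norm2_def x_def prod.case
    by (rule member_le_sum[where f = "\<lambda>j. exp (- (2 * a j * s0)) * (p $ j \<bullet> p $ j)"]) auto
  finally have s0: "y \<le> flow_norm2 a (p, s0)" .
  have "s0 \<le> s1"
    using s0 s1 flow_norm2_strict_antimono[where a = a, OF assms(1) a, of s1 s0] by fastforce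
  moreover have "continuous_on {s0..s1} (\<lambda>s. flow_norm2 a (p, s))"
    by (intro continuous_on_compose2[OF continuous_on_flow_norm2[of UNIV]] continuous_intros) auto
  ultimately show ?thesis
    using IVT2'[of "\<lambda>s. flow_norm2 a (p, s)" s1 y s0] s0 s1 by auto
qed

text \<open>For positive \<open>a\<close> and \<open>r\<close> this is the signed travel time from
  the sphere to \<open>p\<close>, negative inside the ball. At \<open>p = 0\<close> the description
  has no solution when \<open>r\<close> is nonzero, so the facts below exclude that point.\<close>

definition hitting_time :: "('n::finite \<Rightarrow> real) \<Rightarrow> real \<Rightarrow> quat ^ 'n \<Rightarrow> real" where
  "hitting_time a r p = (THE s. flow_norm2 a (p, s) = r\<^sup>2)"

context
  fixes a :: "'n::finite \<Rightarrow> real" and r :: real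
  assumes a_pos: "\<And>j. a j > 0" and r_pos: "r > 0"
begin

lemma flow_norm2_eq_iff:
  assumes "p \<noteq> 0"
  shows "flow_norm2 a (p, s) = r\<^sup>2 \<longleftrightarrow> s = hitting_time a r p"
proof -
  have ex1: "\<exists>!s. flow_norm2 a (p, s) = r\<^sup>2"
    using flow_norm2_surj[where a = a, OF assms a_pos, of "r\<^sup>2"] r_pos inj_flow_norm2[where a = a, OF assms a_pos]
    by (metis injD zero_less_power)
  show ?thesis
    using theI'[OF ex1] ex1 unfolding hitting_time_def by blast
qed

lemma hitting_time_has_derivative:
  assumes "p \<noteq> 0"
  defines "s \<equiv> hitting_time a r p"
  shows "(hitting_time a r has_derivative
     (\<lambda>v. (\<Sum>j\<in>UNIV. exp (- (2 * a j * s)) * (2 * (p $ j \<bullet> v $ j))) /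
          (\<Sum>j\<in>UNIV. 2 * a j * (exp (- (2 * a j * s)) * (p $ j \<bullet> p $ j))))) (at p)"
proof -
  \<comment> \<open>Regrouped with weights \<open>2 * a j * exp (...)\<close>, minus the
    \<open>s\<close>-derivative is positive, so the coefficient \<open>c\<close> does not
    vanish.\<close>
  have "0 < (\<Sum>j\<in>UNIV. (2 * a j * exp (- (2 * a j * s))) * (p $ j \<bullet> p $ j))"
    using assms a_pos by (intro sum_weighted_inner_pos) auto
  then have nz: "- (\<Sum>j\<in>UNIV. 2 * a j * (exp (- (2 * a j * s)) * (p $ j \<bullet> p $ j))) \<noteq> 0"
    by (simp add: mult.assoc)
  have "open (UNIV - {0 :: quat ^ 'n})"
    by (simp add: open_delete)
  from implicit_function_has_derivative[where \<tau> = "hitting_time a r" and y = "r\<^sup>2",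
      OF this continuous_on_flow_norm2 _ _ _ flow_norm2_has_derivative nz[unfolded s_def]]
  show ?thesis
    using assms inj_flow_norm2[where a = a, OF _ a_pos] flow_norm2_eq_iff by simp
qed

text \<open>The derivative formula involves the hitting time but none of its derivatives, so class
  \<open>k\<close> of the function gives class \<open>k\<close> of its derivative.\<close>

lemma Ck_on_hitting_time: "Ck_on k (hitting_time a r) (UNIV - {0})"
proof (induction k)
  case 0
  then show ?case
    using hitting_time_has_derivative[THEN has_derivative_continuous]
    by (auto intro: continuous_at_imp_continuous_on)
next
  case (Suc k)
  have op: "open (UNIV - {0 :: quat ^ 'n})"
    by (simp add: open_delete)
  have nth: "Ck_on k (\<lambda>p :: quat ^ 'n. p $ j) (UNIV - {0})" for j
    by (rule Ck_on_linear[OF op bounded_linear_vec_nth])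
  have ex: "Ck_on k (\<lambda>p. exp (- (2 * a j * hitting_time a r p))) (UNIV - {0})" for j
    unfolding minus_mult_left
    by (intro Ck_on_exp Ck_on_mult Ck_on_const op Suc.IH)
  have "(\<Sum>j\<in>UNIV. (2 * a j * exp (- (2 * a j * s))) * (p $ j \<bullet> p $ j)) > 0"
    if "p \<noteq> 0" for p :: "quat ^ 'n" and s
    using that a_pos by (intro sum_weighted_inner_pos) auto
  then have nz: "(\<Sum>j\<in>UNIV. 2 * a j * (exp (- (2 * a j * s)) * (p $ j \<bullet> p $ j))) \<noteq> 0"
    if "p \<noteq> 0" for p :: "quat ^ 'n" and s
    using that by (metis (no_types, lifting) less_irrefl mult.assoc sum.cong)
  show ?case
    by (rule Ck_on_SucI[OF op hitting_time_has_derivative])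
      (auto intro!: Ck_on_divide Ck_on_sum Ck_on_mult Ck_on_const Ck_on_inner op nth ex nz)
qed

end

section \<open>The flow in the direction of \<open>\<xi>\<close>\<close>

lemma norm_action_power2:
  "(norm (action \<Lambda> (- (s *\<^sub>R \<xi>)) p))\<^sup>2 = flow_norm2 (\<lambda>j. \<Lambda> j \<bullet> \<xi>) (p, s)"
proof -
  have "exp (- (s * c)) * exp (- (s * c)) = exp (- (2 * c * s))" for c :: real
    by (simp add: mult_exp_exp)
  then have exp2: "exp (- (s * c)) * (exp (- (s * c)) * d) = exp (- (2 * c * s)) * d" for c d :: real
    by (metis mult.assoc)
  show ?thesis
    unfolding power2_norm_eq_inner inner_vec_def[of "action _ _ _"]
    by (simp add: action_def flow_norm2_def exp2)
qed

lemma action_eq_0_iff [simp]: "action \<Lambda> T q = 0 \<longleftrightarrow> q = 0"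
  by (simp add: action_def vec_eq_iff)

text \<open>The converse direction acts by \<open>- T\<close>. This is the invariance needed when a
  single leaf plays the role of \<open>M\<close> below.\<close>

lemma action_in_orbit_iff: "action \<Lambda> T p \<in> orbit \<Lambda> q \<longleftrightarrow> p \<in> orbit \<Lambda> q"
proof -
  have "action \<Lambda> S x \<in> orbit \<Lambda> q" if x: "x \<in> orbit \<Lambda> q" for S x
    using x by (auto simp: orbit_def action_add[symmetric])
  from this[of p T] this[of "action \<Lambda> T p" "- T"] show ?thesis
    by (auto simp: action_add[symmetric])
qed

lemma Ck_on_action:
  fixes \<Lambda> :: "'n::finite \<Rightarrow> quat ^ 'm::finite"
  assumes "open U" and "Ck_on k f U" and "Ck_on k g U"
  shows "Ck_on k (\<lambda>x. action \<Lambda> (f x *\<^sub>R \<xi>) (g x)) U"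
  unfolding action_def inner_scaleR_right
  by (intro Ck_on_vec_lambda Ck_on_scaleR Ck_on_exp Ck_on_mult Ck_on_const assms
      Ck_on_compose_linear[OF _ bounded_linear_vec_nth])

text \<open>The set \<open>M\<close> stands for both the punctured space and a single leaf: flowing
  forward or back stays in any invariant set, so one inverse formula serves all cases.\<close>

lemma diffeomorphism_on_Theta:
  fixes \<Lambda> :: "'n::finite \<Rightarrow> quat ^ 'm::finite"
  assumes pos: "\<And>j. \<Lambda> j \<bullet> \<xi> > 0" and "r > 0"
    and "0 \<notin> M" and inv: "\<And>T p. action \<Lambda> T p \<in> M \<longleftrightarrow> p \<in> M"
  shows "diffeomorphism_on (Theta \<Lambda> \<xi>) ((M \<inter> sphere 0 r) \<times> UNIV) M"
proof -
  define \<tau> where "\<tau> = hitting_time (\<lambda>j. \<Lambda> j \<bullet> \<xi>) r"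
  define G where "G = (\<lambda>p. (action \<Lambda> ((- \<tau> p) *\<^sub>R \<xi>) p, \<tau> p))"
  have \<tau>: "norm (action \<Lambda> (- (s *\<^sub>R \<xi>)) p) = r \<longleftrightarrow> s = \<tau> p" if "p \<noteq> 0" for s p
    unfolding \<tau>_def flow_norm2_eq_iff[where a = "\<lambda>j. \<Lambda> j \<bullet> \<xi>", OF pos \<open>r > 0\<close> that, symmetric]
      norm_action_power2[symmetric]
    using \<open>r > 0\<close> by simp
  have op: "open (UNIV - {0 :: quat ^ 'n})"
    by (simp add: open_delete)
  show ?thesis
  \<comment> \<open>Both formulas are smooth on open sets of the ambient space, and their
    restrictions handle leaves that are not open.\<close>
  proof (rule diffeomorphism_onI[where g = G and U = UNIV and V = "UNIV - {0}"])
    fix z assume "z \<in> (M \<inter> sphere 0 r) \<times> (UNIV :: real set)"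
    then obtain q t where z: "z = (q, t)" "q \<in> M" "norm q = r"
      by auto
    then have "q \<noteq> 0" using \<open>r > 0\<close> by auto
    \<comment> \<open>Flowing back for time \<open>t\<close> returns to \<open>q\<close>, which has
      norm \<open>r\<close>; uniqueness of the hitting time identifies \<open>t\<close>.\<close>
    then have "t = \<tau> (action \<Lambda> (t *\<^sub>R \<xi>) q)"
      using z by (subst \<tau>[symmetric]) (auto simp: action_add[symmetric])
    then show "G (Theta \<Lambda> \<xi> z) = z"
      using z by (simp add: G_def Theta_def action_add[symmetric])
    show "Theta \<Lambda> \<xi> z \<in> M"
      using z by (simp add: Theta_def inv)
  next
    fix p assume "p \<in> M"
    with \<open>0 \<notin> M\<close> have "p \<noteq> 0" by auto
    with \<tau>[OF this, of "\<tau> p"] \<open>p \<in> M\<close> show "G p \<in> (M \<inter> sphere 0 r) \<times> UNIV"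
      by (simp add: G_def inv)
    show "Theta \<Lambda> \<xi> (G p) = p"
      by (simp add: G_def Theta_def action_add[symmetric])
  next
    show "Ck_on k (Theta \<Lambda> \<xi>) UNIV" for k
      unfolding Theta_def case_prod_beta
      by (intro Ck_on_action Ck_on_linear bounded_linear_fst bounded_linear_snd open_UNIV)
    show "Ck_on k G (UNIV - {0})" for k
      unfolding G_def \<tau>_def
      by (intro Ck_on_Pair Ck_on_action op Ck_on_hitting_time[where a = "\<lambda>j. \<Lambda> j \<bullet> \<xi>", OF pos \<open>r > 0\<close>]
          Ck_on_linear[OF _ bounded_linear_ident]
          Ck_on_compose_linear[OF _ bounded_linear_minus[OF bounded_linear_ident]])
  qed (use \<open>0 \<notin> M\<close> op in auto)
qed

theorem theorem15p4:
  fixes \<Lambda> :: "'n::finite \<Rightarrow> quat ^ 'm::finite" and \<xi> :: "quat ^ 'm" and r :: real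
  assumes "Poincare_domain \<Lambda>"
    and "\<And>j. \<Lambda> j \<bullet> \<xi> > 0"
    and "r > 0"
  shows "diffeomorphism_on (Theta \<Lambda> \<xi>) (sphere 0 r \<times> UNIV) (UNIV - {0})
    \<and> (\<forall>L\<in>punctured_foliation \<Lambda>.
          diffeomorphism_on (Theta \<Lambda> \<xi>) ((L \<inter> sphere 0 r) \<times> UNIV) L)
    \<and> is_open_cone_over (Theta \<Lambda> \<xi>) (punctured_foliation \<Lambda>) (trace_foliation \<Lambda> r)"
proof (intro conjI)
  have "(UNIV - {0}) \<inter> sphere 0 r = sphere (0 :: quat ^ 'n) r"
    using \<open>r > 0\<close> by auto
  with diffeomorphism_on_Theta[where \<Lambda> = \<Lambda>, OF assms(2,3), where M = "UNIV - {0}"]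
  show "diffeomorphism_on (Theta \<Lambda> \<xi>) (sphere 0 r \<times> UNIV) (UNIV - {0})"
    by simp
  show leaf: "\<forall>L\<in>punctured_foliation \<Lambda>.
      diffeomorphism_on (Theta \<Lambda> \<xi>) ((L \<inter> sphere 0 r) \<times> UNIV) L"
  proof
    fix L assume "L \<in> punctured_foliation \<Lambda>"
    then obtain q where "L = orbit \<Lambda> q" "0 \<notin> L"
      by (auto simp: punctured_foliation_def foliation_def)
    then show "diffeomorphism_on (Theta \<Lambda> \<xi>) ((L \<inter> sphere 0 r) \<times> UNIV) L"
      by (intro diffeomorphism_on_Theta assms) (auto simp: action_in_orbit_iff)
  qed
  \<comment> \<open>Surjectivity of the leafwise diffeomorphisms recovers each leaf from its trace,
    and mapping this over all leaves is the cone property.\<close>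
  then have "Theta \<Lambda> \<xi> ` ((L \<inter> sphere 0 r) \<times> UNIV) = L" if "L \<in> punctured_foliation \<Lambda>" for L
    using that by (simp add: diffeomorphism_on_def bij_betw_def)
  then show "is_open_cone_over (Theta \<Lambda> \<xi>) (punctured_foliation \<Lambda>) (trace_foliation \<Lambda> r)"
    by (simp add: is_open_cone_over_def trace_foliation_def image_image)
qed

end
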